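(* Let $0<q<1$ and let $a$ be a complex number with $|a|<1$. Then $$ \sum_{k=0}^{\infty}\zeta[2k+2]a^{2k}=\sum_{n=1}^{\infty} \frac{q^n}{[n]_q^2-a^2q^{2n}}= \sum_{n=1}^{\infty} \frac{q^{n^2}(1+2q^n)}{\genfrac{[}{]}{0pt}{}{2n}{n}_q([n]_q^2-a^2q^{2n})} \prod_{m=1}^{n-1}\frac{[m]_q^2-a^2(q^m+1)^2}{[m]_q^2-a^2q^{2m}}. $$ In particular, $$ \zeta[2]=\sum_{n=1}^{\infty} \frac{q^{n^2}(1+2q^n)}{\genfrac{[}{]}{0pt}{}{2n}{n}_q[n]_q^2}. $$
   Context: Throughout, $0<q<1$. For a positive integer $n$, $[n]_q=\frac{1-q^n}{1-q}=\sum_{k=0}^{n-1}q^k$. The $q$-shifted factorial is $(a;q)_0=1$ and $(a;q)_n=(1-a)(1-aq)\cdots(1-aq^{n-1})$ for $n\ge1$, and the $q$-binomial coefficient is $\genfrac{[}{]}{0pt}{}{n}{k}_q=\frac{(q;q)_n}{(q;q)_k(q;q)_{n-k}}$ for integers $n\ge k\ge 0$. The $q$-analogue of the Riemann zeta function is $\zeta[s]=\sum_{n=1}^{\infty}\frac{q^{n(s-1)}}{[n]_q^s}$. *)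

theory Defs
  imports "HOL-Analysis.Analysis"
begin

definition q_int :: "'a::field \<Rightarrow> nat \<Rightarrow> 'a" where
  "q_int q n = (1 - q ^ n) / (1 - q)"

definition q_pochhammer :: "'a::field \<Rightarrow> 'a \<Rightarrow> nat \<Rightarrow> 'a" where
  "q_pochhammer a q n = (\<Prod>i<n. 1 - a * q ^ i)"

(* Only meaningful for k \<le> n: the subtraction is truncated. *)
definition q_binomial :: "'a::field \<Rightarrow> nat \<Rightarrow> nat \<Rightarrow> 'a" where
  "q_binomial q n k =
     q_pochhammer q q n / (q_pochhammer q q k * q_pochhammer q q (n - k))"

definition q_zeta_term :: "real \<Rightarrow> complex \<Rightarrow> nat \<Rightarrow> complex" where
  "q_zeta_term q s n =
     of_real q powr (of_nat n * (s - 1)) / of_real (q_int q n) powr s"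

definition q_zeta :: "real \<Rightarrow> complex \<Rightarrow> complex" where
  "q_zeta q s = (\<Sum>n. q_zeta_term q s (Suc n))"

lemma q_int_eq_sum: "q \<noteq> 1 \<Longrightarrow> q_int q n = (\<Sum>k<n. q ^ k)"
  by (simp add: q_int_def geometric_sum divide_simps algebra_simps)

lemma q_int_ge_1:
  fixes q :: real
  assumes "0 < q" "q < 1" "n > 0"
  shows "q_int q n \<ge> 1"
proof -
  have "q ^ n \<le> q ^ 1" using assms by (intro power_decreasing) auto
  then show ?thesis using assms by (simp add: q_int_def)
qed

(* The series defining q_zeta converges (so that its suminf is a genuine value) for Re s > 1. *)
lemma summable_q_zeta_term:
  assumes "0 < q" "q < 1" "Re s > 1"
  shows "summable (\<lambda>n. q_zeta_term q s (Suc n))"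
proof (rule summable_comparison_test')
  have r: "norm (q powr (Re s - 1)) < 1"
    using assms by (simp add: powr01_less_one)
  then show "summable (\<lambda>n. (q powr (Re s - 1)) ^ Suc n)"
    by (subst summable_Suc_iff) (rule summable_geometric)
  fix n :: nat
  have ge: "q_int q (Suc n) \<ge> 1" using assms by (intro q_int_ge_1) auto
  have num: "norm (complex_of_real q powr (of_nat (Suc n) * (s - 1)))
      = (q powr (Re s - 1)) ^ Suc n"
  proof -
    have "norm (complex_of_real q powr (of_nat (Suc n) * (s - 1)))
        = q powr (real (Suc n) * (Re s - 1))"
      using assms by (subst norm_powr_real_powr) auto
    also have "\<dots> = (q powr (Re s - 1)) powr real (Suc n)"
      by (simp add: powr_powr mult.commute)
    also have "\<dots> = (q powr (Re s - 1)) ^ Suc n"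
      using assms by (intro powr_realpow) auto
    finally show ?thesis .
  qed
  have den: "norm (complex_of_real (q_int q (Suc n)) powr s) \<ge> 1"
    using assms ge by (subst norm_powr_real_powr) (auto intro: ge_one_powr_ge_zero)
  have "norm (q_zeta_term q s (Suc n))
      = (q powr (Re s - 1)) ^ Suc n / norm (complex_of_real (q_int q (Suc n)) powr s)"
    unfolding q_zeta_term_def norm_divide num ..
  also have "\<dots> \<le> (q powr (Re s - 1)) ^ Suc n / 1"
    using den assms by (intro divide_left_mono) auto
  finally show "norm (q_zeta_term q s (Suc n)) \<le> (q powr (Re s - 1)) ^ Suc n"
    by simp
qed

end

theory Submission
  imports Defs
begin

text \<open>
  Put x = a (1 - q), u = 1 + x, v = 1 - x. Then
  (1 - q)^2 ([m]^2 - a^2 q^(2m)) = (1 - u q^m) (1 - v q^m) and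
  (1 - q)^2 ([m]^2 - a^2 (q^m + 1)^2) = (v - u q^m) (u - v q^m), and the second equality
  comes from a q-analogue of a WZ pair for Dougall's bilateral 2H2 sum:
  T n y - T (n + 1) y = G n y - G n (q y), where (1 - q)^2 T 0 (q^k) is the k-th term of the
  middle series. Summing over y = q, q^2, ... telescopes the right-hand side to G n q, and for
  u + v = 2 the number (1 - q)^2 G n q is the term with index n + 1 of the last series, while
  the sum of T N over these y is O(C^N q^(N^2)). The first equality is a geometric expansion.
\<close>

section \<open>Limits for exchanging summations\<close>

text \<open>The remainders \<open>r N\<close> sum to F minus the N-th partial sum of c, and this is
  at most \<open>B N * suminf w\<close> in norm. Both equalities of the theorem use this:
  \<open>r N\<close> is a geometric tail in the first and the WZ term of index N in the
  second.\<close>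

lemma sums_by_vanishing_remainders:
  fixes f c :: "nat \<Rightarrow> 'a::banach" and r :: "nat \<Rightarrow> nat \<Rightarrow> 'a"
  assumes f: "f sums F" and w: "summable w" and B: "B \<longlonglongrightarrow> 0"
    and r: "\<And>N k. norm (r N k) \<le> B N * w k"
    and c: "\<And>N. (\<lambda>k. f k - r N k) sums (\<Sum>n<N. c n)"
  shows "c sums F"
proof -
  have "norm ((\<Sum>n<N. c n) - F) \<le> B N * suminf w" for N
  proof -
    have s: "(\<lambda>k. r N k) sums (F - (\<Sum>n<N. c n))"
      using sums_diff[OF f c[of N]] by simp
    have "norm (suminf (r N)) \<le> (\<Sum>k. B N * w k)"
      by (rule norm_suminf_le[OF r[of N] summable_mult[OF w]])
    then show ?thesis
      using sums_unique[OF s] suminf_mult[OF w, of "B N"] by (simp add: norm_minus_commute)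
  qed
  moreover have "(\<lambda>N. B N * suminf w) \<longlonglongrightarrow> 0"
    using tendsto_mult_left_zero[OF B] by simp
  ultimately have "(\<lambda>N. (\<Sum>n<N. c n) - F) \<longlonglongrightarrow> 0"
    by (rule Lim_null_comparison[OF always_eventually[OF allI]])
  then show ?thesis
    by (simp add: sums_def LIM_zero_iff)
qed

text \<open>The expression is the n-th power of q^n C, and q^n C is eventually below 1/2.\<close>

lemma power_square_times_power_tendsto_0:
  fixes q C :: real
  assumes "0 < q" "q < 1" "0 \<le> C"
  shows "(\<lambda>n. q ^ (n\<^sup>2) * C ^ n) \<longlonglongrightarrow> 0"
proof (rule Lim_null_comparison)
  have "(\<lambda>n. q ^ n * C) \<longlonglongrightarrow> 0"
    using assms by (intro tendsto_mult_left_zero LIMSEQ_realpow_zero) auto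
  then have "eventually (\<lambda>n. q ^ n * C < 1/2) sequentially"
    by (rule order_tendstoD) simp
  then show "eventually (\<lambda>n. norm (q ^ (n\<^sup>2) * C ^ n) \<le> (1/2) ^ n) sequentially"
  proof eventually_elim
    case (elim n)
    have "q ^ (n\<^sup>2) * C ^ n = (q ^ n * C) ^ n"
      by (simp add: power_mult_distrib power_mult power2_eq_square)
    also have "\<dots> \<le> (1/2) ^ n"
      using elim assms by (intro power_mono) auto
    finally show ?case using assms by simp
  qed
qed (rule LIMSEQ_realpow_zero, auto)

section \<open>The WZ pair\<close>

definition qcoef :: "'a::field \<Rightarrow> nat \<Rightarrow> 'a" where
  "qcoef q n = q ^ (n\<^sup>2) / q_binomial q (2 * n) n"

definition wz_numer :: "'a::field \<Rightarrow> 'a \<Rightarrow> 'a \<Rightarrow> nat \<Rightarrow> 'a" where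
  "wz_numer q u v n = (\<Prod>m=1..n. (v - u * q ^ m) * (u - v * q ^ m))"

text \<open>The range starts at j = 0, so n = 0 still leaves one pair of factors: up to scaling, the
  denominator in the middle series when y = q^k.\<close>

definition wz_denom :: "'a::field \<Rightarrow> 'a \<Rightarrow> 'a \<Rightarrow> nat \<Rightarrow> 'a \<Rightarrow> 'a" where
  "wz_denom q u v n y = (\<Prod>j\<le>n. (1 - u * y * q ^ j) * (1 - v * y * q ^ j))"

definition wz_T :: "'a::field \<Rightarrow> 'a \<Rightarrow> 'a \<Rightarrow> nat \<Rightarrow> 'a \<Rightarrow> 'a" where
  "wz_T q u v n y = qcoef q n * wz_numer q u v n * y ^ (2 * n + 1) / wz_denom q u v n y"

text \<open>This is \<open>wz_T\<close> times a rational function of q, q^n and y, the WZ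
  certificate. The two factors dividing \<open>qcoef q n\<close> are those in its recurrence, so one
  coefficient serves index n and index n + 1.\<close>

definition wz_G :: "'a::field \<Rightarrow> 'a \<Rightarrow> 'a \<Rightarrow> nat \<Rightarrow> 'a \<Rightarrow> 'a" where
  "wz_G q u v n y = qcoef q n / ((1 + q ^ Suc n) * (1 - q ^ (2 * n + 1))) * wz_numer q u v n
     * y ^ (2 * n + 1) * (1 + q ^ Suc n - (u + v) * q ^ (2 * n + 1) * y) / wz_denom q u v n y"

section \<open>Recurrences in n and the WZ identity\<close>

lemma q_pochhammer_Suc: "q_pochhammer a q (Suc n) = q_pochhammer a q n * (1 - a * q ^ n)"
  by (simp add: q_pochhammer_def)

lemma q_pochhammer_self_nonzero:
  assumes "\<And>j. j > 0 \<Longrightarrow> q ^ j \<noteq> (1::'a::field)"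
  shows "q_pochhammer q q n \<noteq> 0"
  using assms[of "Suc _"] by (auto simp: q_pochhammer_def)

lemma one_plus_power_nonzero:
  fixes q :: "'a::field"
  assumes "q ^ (2 * n) \<noteq> 1"
  shows "1 + q ^ n \<noteq> 0"
proof
  assume "1 + q ^ n = 0"
  then have "q ^ n = -1" by (simp add: add_eq_0_iff)
  then have "q ^ (2 * n) = 1" by (simp add: power_mult mult.commute[of 2])
  with assms show False by simp
qed

lemma qcoef_0 [simp]: "qcoef q 0 = 1"
  by (simp add: qcoef_def q_binomial_def q_pochhammer_def)

text \<open>The q-binomial ratio simplifies because 1 - q^(2n+2) = (1 - q^(n+1)) (1 + q^(n+1)). The
  grouping isolates the coefficient that occurs in \<open>wz_G\<close>.\<close>

lemma qcoef_Suc: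
  fixes q :: "'a::field"
  assumes q: "\<And>j. j > 0 \<Longrightarrow> q ^ j \<noteq> 1"
  shows "qcoef q (Suc n) =
    qcoef q n / ((1 + q ^ Suc n) * (1 - q ^ (2 * n + 1))) * q ^ (2 * n + 1) * (1 - q ^ Suc n)"
proof -
  note p = q_pochhammer_self_nonzero[OF q]
  have 1: "q_pochhammer q q (2 * Suc n) =
      q_pochhammer q q (2 * n) * (1 - q ^ (2 * n + 1)) * ((1 - q ^ Suc n) * (1 + q ^ Suc n))"
    by (simp add: q_pochhammer_Suc algebra_simps flip: power_add mult_2)
  have 2: "q_pochhammer q q (Suc n) = q_pochhammer q q n * (1 - q ^ Suc n)"
    by (simp add: q_pochhammer_Suc)
  have 3: "q ^ ((Suc n)\<^sup>2) = q ^ (n\<^sup>2) * q ^ (2 * n + 1)"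
  proof -
    have "(Suc n)\<^sup>2 = n\<^sup>2 + (2 * n + 1)" by (simp add: power2_eq_square)
    then show ?thesis by (simp only: power_add)
  qed
  have 4: "1 - q ^ Suc n \<noteq> 0" "1 - q ^ (2 * n + 1) \<noteq> 0"
    using q[of "Suc n"] q[of "2 * n + 1"] by auto
  have 5: "1 + q ^ Suc n \<noteq> 0"
    by (rule one_plus_power_nonzero) (rule q, simp)
  have 6: "2 * Suc n - Suc n = Suc n" "2 * n - n = n" by auto
  show ?thesis
    unfolding qcoef_def q_binomial_def 6 1 2 3
    using p[of n] p[of "2 * n"] 4 5
    by (simp add: divide_simps del: power_Suc)
qed

lemma wz_numer_Suc:
  "wz_numer q u v (Suc n) = wz_numer q u v n * ((v - u * q ^ Suc n) * (u - v * q ^ Suc n))"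
  by (simp add: wz_numer_def)

lemma wz_denom_Suc:
  "wz_denom q u v (Suc n) y =
     wz_denom q u v n y * ((1 - u * y * q ^ Suc n) * (1 - v * y * q ^ Suc n))"
  by (simp add: wz_denom_def)

text \<open>Splitting off the factors with j = 0 instead of the last ones shows that the denominator
  at q y also divides the one of index n + 1 at y.\<close>

lemma wz_denom_shift:
  "wz_denom q u v (Suc n) y = ((1 - u * y) * (1 - v * y)) * wz_denom q u v n (q * y)"
  unfolding wz_denom_def by (subst prod.atMost_Suc_shift) (simp add: algebra_simps)

text \<open>The denominators of index n at y and at q y both divide the one in D, so D makes them
  nonzero too. Over this common denominator all four terms share the factor K E Y R, and a
  polynomial identity remains.\<close>

lemma wz_pair:
  fixes q u v y :: "'a::field"
  assumes q: "\<And>j. j > 0 \<Longrightarrow> q ^ j \<noteq> 1"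
    and D: "wz_denom q u v (Suc n) y \<noteq> 0"
  shows "wz_T q u v n y - wz_T q u v (Suc n) y = wz_G q u v n y - wz_G q u v n (q * y)"
proof -
  define K where "K = qcoef q n / ((1 + q ^ Suc n) * (1 - q ^ (2 * n + 1)))"
  define R where "R = 1 / wz_denom q u v (Suc n) y"
  define E where "E = wz_numer q u v n"
  define Y where "Y = y ^ (2 * n + 1)"
  define b where "b = q ^ (2 * n + 1)"
  define c where "c = q ^ Suc n"
  have b: "b * q = c * c"
    by (simp add: b_def c_def algebra_simps flip: power_add mult_2)
  have nz: "1 + c \<noteq> 0" "1 - b \<noteq> 0"
    unfolding c_def b_def using one_plus_power_nonzero[of q "Suc n"] q[of "2 * Suc n"] q[of "2*n+1"]
    by auto
  have L: "qcoef q n = K * ((1 + c) * (1 - b))"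
    using nz unfolding K_def c_def[symmetric] b_def[symmetric] by simp
  have LS: "qcoef q (Suc n) = K * b * (1 - c)"
    unfolding K_def c_def b_def by (rule qcoef_Suc[OF q])
  have d1: "1 / wz_denom q u v n y = ((1 - u * y * c) * (1 - v * y * c)) * R"
    using D unfolding R_def wz_denom_Suc c_def by simp
  have d2: "1 / wz_denom q u v n (q * y) = ((1 - u * y) * (1 - v * y)) * R"
    using D unfolding R_def wz_denom_shift by simp
  have T: "wz_T q u v n y = K * ((1 + c) * (1 - b)) * E * Y * (1 / wz_denom q u v n y)"
    unfolding wz_T_def L E_def Y_def by simp
  have TS: "wz_T q u v (Suc n) y =
      K * b * (1 - c) * (E * ((v - u * c) * (u - v * c))) * (Y * (y * y)) * R"
    unfolding wz_T_def LS wz_numer_Suc E_def Y_def R_def c_def by simp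
  have G: "wz_G q u v n y = K * E * Y * (1 + c - (u + v) * b * y) * (1 / wz_denom q u v n y)"
    unfolding wz_G_def K_def c_def E_def Y_def b_def by simp
  have GS: "wz_G q u v n (q * y) =
      K * E * (b * Y) * (1 + c - (u + v) * (b * q) * y) * (1 / wz_denom q u v n (q * y))"
    unfolding wz_G_def K_def c_def E_def Y_def b_def by (simp add: power_mult_distrib mult_ac)
  \<comment> \<open>With b q already replaced by c^2, this holds identically in u, v, y, b, c as
    independent variables.\<close>
  have "(1 + c) * (1 - b) * ((1 - u * y * c) * (1 - v * y * c))
        - b * (1 - c) * ((v - u * c) * (u - v * c)) * (y * y)
      = (1 + c - (u + v) * b * y) * ((1 - u * y * c) * (1 - v * y * c))
        - b * (1 + c - (u + v) * (c * c) * y) * ((1 - u * y) * (1 - v * y))" (is "?l = ?r")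
    by (simp add: algebra_simps)
  then have "K * E * Y * R * ?l = K * E * Y * R * ?r" by (rule arg_cong)
  then show ?thesis
    unfolding T TS G GS d1 d2 b right_diff_distrib[of "K * E * Y * R"] by (simp only: mult_ac)
qed

section \<open>Size of the WZ terms, and summation over the powers of q\<close>

lemma qcoef_of_real: "qcoef (complex_of_real q) n = of_real (qcoef q n)"
  by (simp add: qcoef_def q_binomial_def q_pochhammer_def)

text \<open>In effect, the central q-binomial coefficient is at least 1. Each step multiplies
  \<open>qcoef\<close> by q^(2n+1), the increment from n^2 to (n+1)^2 in the exponent, and by a
  ratio in [0, 1].\<close>

lemma qcoef_bounds:
  fixes q :: real
  assumes q: "0 < q" "q < 1"
  shows "0 \<le> qcoef q n \<and> qcoef q n \<le> q ^ (n\<^sup>2)"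
proof (induction n)
  case (Suc n)
  define b where "b = q ^ (2 * n + 1)"
  define c where "c = q ^ Suc n"
  have bc: "0 < b" "b \<le> c" "c < 1"
    unfolding b_def c_def using q by (auto intro!: power_decreasing power_Suc_less_one simp del: power_Suc)
  have "q ^ j \<noteq> 1" if "j > 0" for j
    using power_strict_decreasing[of 0 j q] that q by auto
  then have L: "qcoef q (Suc n) = (qcoef q n * b) * ((1 - c) / ((1 + c) * (1 - b)))"
    unfolding b_def c_def by (subst qcoef_Suc) auto
  \<comment> \<open>The ratio is at most 1 because b \<le> c: the exponent 2n+1 is at least
    n+1.\<close>
  have "1 - b \<le> (1 + c) * (1 - b)"
    using bc by (simp add: mult_le_cancel_right1)
  then have "1 - c \<le> (1 + c) * (1 - b)"
    using bc by linarith
  then have R: "0 \<le> (1 - c) / ((1 + c) * (1 - b))" "(1 - c) / ((1 + c) * (1 - b)) \<le> 1"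
    using bc by (auto simp: divide_le_eq_1 intro!: divide_nonneg_nonneg mult_nonneg_nonneg mult_pos_pos)
  have e: "(Suc n)\<^sup>2 = n\<^sup>2 + (2 * n + 1)" by (simp add: power2_eq_square)
  have "qcoef q n * b \<le> q ^ (n\<^sup>2) * b"
    using Suc bc by (intro mult_right_mono) auto
  moreover have "qcoef q (Suc n) \<le> qcoef q n * b"
    unfolding L using R Suc bc by (intro mult_left_le) auto
  ultimately have "qcoef q (Suc n) \<le> q ^ ((Suc n)\<^sup>2)"
    unfolding e power_add b_def by linarith
  moreover have "0 \<le> qcoef q (Suc n)"
    unfolding L using R Suc bc by (intro mult_nonneg_nonneg) auto
  ultimately show ?case by blast
qed simp

text \<open>The odd power of y vanishes at 0 while the denominator tends to 1. This removes the
  boundary term at infinity when telescoping over y = Q^(k+1).\<close>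

lemma wz_G_tendsto_0:
  fixes q u v :: complex
  assumes "y \<longlonglongrightarrow> 0"
  shows "(\<lambda>k. wz_G q u v n (y k)) \<longlonglongrightarrow> 0"
proof -
  have "(\<lambda>k. wz_denom q u v n (y k))
          \<longlonglongrightarrow> (\<Prod>j\<le>n. (1 - u * 0 * q ^ j) * (1 - v * 0 * q ^ j))"
    unfolding wz_denom_def by (intro tendsto_intros assms)
  then have D: "(\<lambda>k. wz_denom q u v n (y k)) \<longlonglongrightarrow> 1" by simp
  have "(\<lambda>k. wz_G q u v n (y k)) \<longlonglongrightarrow>
      qcoef q n / ((1 + q ^ Suc n) * (1 - q ^ (2 * n + 1))) * wz_numer q u v n
      * 0 ^ (2 * n + 1) * (1 + q ^ Suc n - (u + v) * q ^ (2 * n + 1) * 0) / 1"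
    unfolding wz_G_def by (intro tendsto_intros assms D one_neq_zero)
  then show ?thesis by simp
qed

text \<open>The constant \<open>\<delta>\<close> keeps all linear factors of the denominators away
  from 0 uniformly in k. A WZ term of index N then grows at most geometrically in N apart from the
  factor q^(N^2), which dominates.\<close>

lemma wz_sums:
  fixes q \<delta> :: real and u v :: complex
  defines "Q \<equiv> complex_of_real q"
  assumes q: "0 < q" "q < 1" and \<delta>: "0 < \<delta>"
    and u: "\<And>j. j > 0 \<Longrightarrow> \<delta> \<le> norm (1 - u * Q ^ j)"
    and v: "\<And>j. j > 0 \<Longrightarrow> \<delta> \<le> norm (1 - v * Q ^ j)"
  shows "summable (\<lambda>k. wz_T Q u v 0 (Q ^ Suc k))"
    and "(\<lambda>n. wz_G Q u v n Q) sums (\<Sum>k. wz_T Q u v 0 (Q ^ Suc k))"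
proof -
  \<comment> \<open>M bounds one pair of numerator factors, as powers of Q have norm at most 1. The
    last division in B is there because a denominator has N + 1 pairs of factors and a numerator
    only N.\<close>
  define M where "M = (norm u + norm v)\<^sup>2"
  define B where "B = (\<lambda>N. q ^ (N\<^sup>2) * (M / \<delta>\<^sup>2) ^ N / \<delta>\<^sup>2)"
  have nQ: "norm (Q ^ j) = q ^ j" for j
    using q by (simp add: Q_def norm_power)
  have Q1: "Q ^ j \<noteq> 1" if "j > 0" for j
    using nQ[of j] power_strict_decreasing[of 0 j q] that q by auto
  have numer: "norm (wz_numer Q u v N) \<le> M ^ N" for N
  proof -
    have fac: "norm (s - t * Q ^ m) \<le> norm s + norm t" for s t m
    proof -
      have "norm t * q ^ m \<le> norm t * 1"
        using q by (intro mult_left_mono power_le_one) auto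
      then show ?thesis
        using norm_triangle_ineq4[of s "t * Q ^ m"] by (simp only: norm_mult nQ)
    qed
    have "norm (wz_numer Q u v N) \<le> (\<Prod>m=1..N. M)"
      unfolding wz_numer_def prod_norm[symmetric] norm_mult
    proof (intro prod_mono conjI)
      fix m
      show "norm (v - u * Q ^ m) * norm (u - v * Q ^ m) \<le> M"
        using mult_mono[OF fac[of v u m] fac[of u v m]]
        by (simp add: M_def power2_eq_square add.commute)
    qed simp
    then show ?thesis by simp
  qed
  have denom: "(\<delta>\<^sup>2) ^ Suc N \<le> norm (wz_denom Q u v N (Q ^ Suc k))" for N k
  proof -
    have "(\<Prod>j\<le>N. \<delta>\<^sup>2) \<le> norm (wz_denom Q u v N (Q ^ Suc k))"
      unfolding wz_denom_def prod_norm[symmetric] norm_mult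
    proof (intro prod_mono conjI)
      fix j
      show "\<delta>\<^sup>2 \<le> norm (1 - u * Q ^ Suc k * Q ^ j) * norm (1 - v * Q ^ Suc k * Q ^ j)"
        using mult_mono[OF u[of "Suc k + j"] v[of "Suc k + j"]] \<delta>
        by (simp add: power2_eq_square power_add mult_ac)
    qed (use \<delta> in simp)
    then show ?thesis by simp
  qed
  have denom_nz: "wz_denom Q u v N (Q ^ Suc k) \<noteq> 0" for N k
  proof -
    have "0 < (\<delta>\<^sup>2) ^ Suc N" using \<delta> by (intro zero_less_power) simp
    then show ?thesis using denom[of N k] by (auto simp del: power_Suc)
  qed
  have bound: "norm (wz_T Q u v N (Q ^ Suc k)) \<le> B N * q ^ k" for N k
  proof -
    \<comment> \<open>The exponent (k+1)(2N+1) is cut down to k: decay in k uniform in N suffices,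
      since B carries the decay in N.\<close>
    have y: "norm ((Q ^ Suc k) ^ (2 * N + 1)) \<le> q ^ k"
      unfolding power_mult[symmetric] nQ using q by (intro power_decreasing) auto
    have L: "norm (qcoef Q N) \<le> q ^ (N\<^sup>2)"
      unfolding Q_def qcoef_of_real using qcoef_bounds[OF q, of N] by simp
    have "norm (wz_T Q u v N (Q ^ Suc k))
        = norm (qcoef Q N) * norm (wz_numer Q u v N) * norm ((Q ^ Suc k) ^ (2 * N + 1))
          / norm (wz_denom Q u v N (Q ^ Suc k))"
      unfolding wz_T_def norm_divide norm_mult ..
    also have "\<dots> \<le> q ^ (N\<^sup>2) * M ^ N * q ^ k / (\<delta>\<^sup>2) ^ Suc N"
      using q \<delta> by (intro frac_le mult_mono L numer y denom mult_nonneg_nonneg zero_less_power)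
        (auto simp: M_def)
    also have "\<dots> = B N * q ^ k"
      by (simp add: B_def power_divide)
    finally show ?thesis .
  qed
  have w: "summable (\<lambda>k. q ^ k)"
    using q by (intro summable_geometric) auto
  show f: "summable (\<lambda>k. wz_T Q u v 0 (Q ^ Suc k))"
    by (rule summable_comparison_test'[OF summable_mult[OF w, of "B 0"] bound])
  have "(\<lambda>N. q ^ (N\<^sup>2) * (M / \<delta>\<^sup>2) ^ N) \<longlonglongrightarrow> 0"
    using q by (intro power_square_times_power_tendsto_0) (auto simp: M_def)
  then have B: "B \<longlonglongrightarrow> 0"
    unfolding B_def by (rule tendsto_divide_zero)
  have Q0: "(\<lambda>k. Q ^ Suc k) \<longlonglongrightarrow> 0"
    using q unfolding filterlim_sequentially_Suc by (intro LIMSEQ_power_zero) (simp add: Q_def)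
  show "(\<lambda>n. wz_G Q u v n Q) sums (\<Sum>k. wz_T Q u v 0 (Q ^ Suc k))"
  proof (rule sums_by_vanishing_remainders[OF summable_sums[OF f] w B bound])
    fix N
    \<comment> \<open>For fixed n the differences of G telescope in k, leaving the value at y =
      Q.\<close>
    have "(\<lambda>k. wz_G Q u v n (Q ^ Suc k) - wz_G Q u v n (Q ^ Suc (Suc k))) sums wz_G Q u v n Q" for n
      using telescope_sums'[OF wz_G_tendsto_0[OF Q0, of Q u v n]] by simp
    then have "(\<lambda>k. \<Sum>n<N. wz_G Q u v n (Q ^ Suc k) - wz_G Q u v n (Q * Q ^ Suc k))
        sums (\<Sum>n<N. wz_G Q u v n Q)"
      by (intro sums_sum) simp
    \<comment> \<open>For fixed k the same differences, read as differences of T, telescope in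
      n.\<close>
    moreover have "(\<Sum>n<N. wz_G Q u v n (Q ^ Suc k) - wz_G Q u v n (Q * Q ^ Suc k))
        = wz_T Q u v 0 (Q ^ Suc k) - wz_T Q u v N (Q ^ Suc k)" for k
    proof -
      have "wz_G Q u v n (Q ^ Suc k) - wz_G Q u v n (Q * Q ^ Suc k)
          = wz_T Q u v n (Q ^ Suc k) - wz_T Q u v (Suc n) (Q ^ Suc k)" for n
        by (rule wz_pair[OF _ denom_nz, symmetric]) (rule Q1)
      then show ?thesis by (simp only: sum_lessThan_telescope'[of "\<lambda>n. wz_T Q u v n (Q ^ Suc k)"])
    qed
    ultimately show "(\<lambda>k. wz_T Q u v 0 (Q ^ Suc k) - wz_T Q u v N (Q ^ Suc k))
        sums (\<Sum>n<N. wz_G Q u v n Q)"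
      by (simp only:)
  qed
qed

text \<open>At y = q and u + v = 2 the last numerator factor is 1 + c - 2 c^2 = (1 - c)(1 + 2 c)
  with c = q^(n+1). The factor 1 - c completes the recurrence to \<open>qcoef q (Suc n)\<close>; the
  other is the 1 + 2 q^n of the theorem, at index n + 1.\<close>

lemma wz_G_at_base:
  fixes q u v :: "'a::field"
  assumes q: "\<And>j. j > 0 \<Longrightarrow> q ^ j \<noteq> 1" and uv: "u + v = 2"
  shows "wz_G q u v n q
    = q ^ ((Suc n)\<^sup>2) * (1 + 2 * q ^ Suc n)
      / (q_binomial q (2 * Suc n) (Suc n) * ((1 - u * q ^ Suc n) * (1 - v * q ^ Suc n)))
      * (\<Prod>m=1..n. ((v - u * q ^ m) * (u - v * q ^ m)) / ((1 - u * q ^ m) * (1 - v * q ^ m)))"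
proof -
  define c where "c = q ^ Suc n"
  define b where "b = q ^ (2 * n + 1)"
  define K where "K = qcoef q n / ((1 + c) * (1 - b))"
  have bc: "b * q = c * c"
    by (simp add: b_def c_def algebra_simps flip: power_add mult_2)
  have L: "qcoef q (Suc n) = K * b * (1 - c)"
    unfolding K_def b_def c_def by (rule qcoef_Suc[OF q])
  have "wz_G q u v n q
      = K * wz_numer q u v n * b * (1 + c - 2 * (b * q)) / wz_denom q u v n q"
    unfolding wz_G_def uv K_def b_def c_def by (simp only: mult.assoc)
  also have "1 + c - 2 * (b * q) = (1 - c) * (1 + 2 * c)"
    unfolding bc by algebra
  also have "K * wz_numer q u v n * b * ((1 - c) * (1 + 2 * c)) =
      qcoef q (Suc n) * wz_numer q u v n * (1 + 2 * c)"
    unfolding L by (simp only: mult_ac)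
  \<comment> \<open>Taking y = q turns the index j into m = j + 1. The pair m = n + 1 has no
    counterpart in the numerator and stays outside the final product.\<close>
  also have "wz_denom q u v n q = (\<Prod>m=1..Suc n. (1 - u * q ^ m) * (1 - v * q ^ m))"
    unfolding wz_denom_def
    by (rule prod.reindex_bij_witness[of _ "\<lambda>m. m - 1" Suc]) (auto simp: mult_ac)
  finally show ?thesis
    by (simp add: qcoef_def wz_numer_def prod_dividef c_def mult_ac del: power_Suc)
qed

section \<open>The three series\<close>

text \<open>Even integer exponents turn \<open>powr\<close> into ordinary powers, which exhibits the
  term as a geometric progression in k.\<close>

lemma q_zeta_term_even:
  assumes "0 < q" "q < 1" "n > 0"
  shows "q_zeta_term q (of_nat (2 * k + 2)) n =
    complex_of_real (q ^ n) / of_real (q_int q n) ^ 2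
      * ((of_real q ^ n / of_real (q_int q n))\<^sup>2) ^ k"
proof -
  have Q: "complex_of_real q \<noteq> 0" and I: "complex_of_real (q_int q n) \<noteq> 0"
    using assms q_int_ge_1[of q n] by auto
  have "of_nat n * (of_nat (2 * k + 2) - 1) = (of_nat (n * (2 * k + 1)) :: complex)"
    by (simp add: algebra_simps)
  then have "complex_of_real q powr (of_nat n * (of_nat (2 * k + 2) - 1))
      = of_real q ^ (n * (2 * k + 1))"
    using Q by (simp only: powr_nat' simp_thms)
  moreover have "complex_of_real (q_int q n) powr of_nat (2 * k + 2)
      = of_real (q_int q n) ^ (2 * k + 2)"
    using I by (simp only: powr_nat' simp_thms)
  ultimately show ?thesis
    unfolding q_zeta_term_def
    by (simp add: power_add power_mult power_divide power2_eq_square power_mult_distrib)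
qed

text \<open>Each middle term is a geometric series with ratio \<open>\<rho> n\<close>. Since q^n
  \<le> 1 \<le> [n], the ratio is at most |a|^2 in norm for every n, so the tails after N terms
  vanish uniformly against a summable majorant.\<close>

lemma zeta_generating_sums:
  fixes q :: real and a :: complex
  defines "f \<equiv> \<lambda>n. complex_of_real (q ^ Suc n) /
    (complex_of_real (q_int q (Suc n)) ^ 2 - a ^ 2 * complex_of_real q ^ (2 * Suc n))"
  assumes q: "0 < q" "q < 1" and a: "norm a < 1"
  shows "(\<lambda>k. q_zeta q (of_nat (2 * k + 2)) * a ^ (2 * k)) sums suminf f"
proof -
  define \<rho> where "\<rho> = (\<lambda>n. (a * (of_real q ^ Suc n / complex_of_real (q_int q (Suc n))))\<^sup>2)"
  define h where "h = (\<lambda>n. complex_of_real (q ^ Suc n) / of_real (q_int q (Suc n)) ^ 2)"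
  define w where "w = (\<lambda>n. q ^ Suc n / (1 - (norm a)\<^sup>2))"
  have I: "q_int q (Suc n) \<ge> 1" for n
    by (rule q_int_ge_1) (use q in auto)
  have a2: "(norm a)\<^sup>2 < 1"
    using a by (simp add: power_less_one_iff abs_square_less_1)
  have \<rho>: "norm (\<rho> n) \<le> (norm a)\<^sup>2" for n
  proof -
    have "q ^ Suc n / q_int q (Suc n) \<le> 1"
      using I[of n] power_le_one[of q "Suc n"] q by (subst divide_le_eq_1_pos) auto
    then have "norm a * (q ^ Suc n / q_int q (Suc n)) \<le> norm a"
      using q by (intro mult_left_le) auto
    then show ?thesis
      unfolding \<rho>_def norm_power using I[of n] q
      by (intro power_mono) (auto simp: norm_mult norm_divide norm_power)
  qed
  have \<rho>1: "1 - (norm a)\<^sup>2 \<le> norm (1 - \<rho> n)" for n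
    using \<rho>[of n] norm_triangle_ineq2[of 1 "\<rho> n"] by simp
  have nz: "1 - \<rho> n \<noteq> 0" for n
    using \<rho>1[of n] a2 by auto
  have f: "f n = h n / (1 - \<rho> n)" for n
  proof -
    have "complex_of_real (q_int q (Suc n)) \<noteq> 0"
      using I[of n] by simp
    then have "complex_of_real (q_int q (Suc n)) ^ 2 - a ^ 2 * complex_of_real q ^ (2 * Suc n)
        = of_real (q_int q (Suc n)) ^ 2 * (1 - \<rho> n)"
      unfolding \<rho>_def power_even_eq
      by (simp add: power_mult_distrib power_divide right_diff_distrib del: power_Suc)
    then show ?thesis by (simp only: f_def h_def divide_divide_eq_left)
  qed
  have h: "norm (h n) \<le> q ^ Suc n" for n
  proof -
    have "1 \<le> (q_int q (Suc n))\<^sup>2" using I[of n] by (rule one_le_power)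
    then have "q ^ Suc n / (q_int q (Suc n))\<^sup>2 \<le> q ^ Suc n / 1"
      using q by (intro divide_left_mono) auto
    then show ?thesis
      using q I[of n] by (simp add: h_def norm_divide norm_power norm_mult)
  qed
  have fw: "norm (f n) \<le> w n" for n
    unfolding f norm_divide w_def using h \<rho>1 a2 q by (intro frac_le) auto
  have w: "summable w"
    unfolding w_def using q by (intro summable_divide) (simp add: summable_geometric)
  have sf: "summable f"
    by (rule summable_comparison_test'[OF w fw])
  show ?thesis
  proof (rule sums_by_vanishing_remainders[OF summable_sums[OF sf] w])
    show "(\<lambda>N. ((norm a)\<^sup>2) ^ N) \<longlonglongrightarrow> 0"
      using a2 by (intro LIMSEQ_realpow_zero) auto
    show "norm (f n * \<rho> n ^ N) \<le> ((norm a)\<^sup>2) ^ N * w n" for N n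
      unfolding norm_mult norm_power[of "\<rho> n"] mult.commute[of "norm (f n)"]
      by (intro mult_mono power_mono \<rho> fw) auto
    fix N
    have "(\<lambda>n. q_zeta_term q (of_nat (2 * k + 2)) (Suc n) * a ^ (2 * k))
        sums (q_zeta q (of_nat (2 * k + 2)) * a ^ (2 * k))" for k
      unfolding q_zeta_def using q
      by (intro sums_mult2 summable_sums summable_q_zeta_term) auto
    moreover have "q_zeta_term q (of_nat (2 * k + 2)) (Suc n) * a ^ (2 * k) = h n * \<rho> n ^ k" for n k
      unfolding q_zeta_term_even[OF q zero_less_Suc] h_def \<rho>_def power_mult[of a 2]
      by (simp only: power_mult_distrib mult_ac)
    ultimately have "(\<lambda>n. \<Sum>k<N. h n * \<rho> n ^ k)
        sums (\<Sum>k<N. q_zeta q (of_nat (2 * k + 2)) * a ^ (2 * k))"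
      by (intro sums_sum) simp
    moreover have "(\<Sum>k<N. h n * \<rho> n ^ k) = f n - f n * \<rho> n ^ N" for n
      using nz[of n] unfolding sum_distrib_left[symmetric] f
      by (auto simp: sum_gp_strict right_diff_distrib diff_divide_distrib)
    ultimately show "(\<lambda>n. f n - f n * \<rho> n ^ N)
        sums (\<Sum>k<N. q_zeta q (of_nat (2 * k + 2)) * a ^ (2 * k))"
      by (simp only:)
  qed
qed

lemma of_real_q_int: "of_real (q_int q n) = (1 - complex_of_real q ^ n) / (1 - of_real q)"
  by (simp add: q_int_def)

section \<open>Combining the three series, and the case a = 0\<close>

theorem theorem1:
  fixes q :: real and a :: complex
  assumes "0 < q" and "q < 1" and "norm a < 1"
  shows "(\<exists>S::complex.
       (\<lambda>k. q_zeta q (of_nat (2 * k + 2)) * a ^ (2 * k)) sums S \<and>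
       (\<lambda>n. complex_of_real (q ^ Suc n) /
            (complex_of_real (q_int q (Suc n)) ^ 2 - a ^ 2 * complex_of_real q ^ (2 * Suc n))) sums S \<and>
       (\<lambda>n. complex_of_real (q ^ (Suc n ^ 2) * (1 + 2 * q ^ Suc n)) /
            (complex_of_real (q_binomial q (2 * Suc n) (Suc n)) *
              (complex_of_real (q_int q (Suc n)) ^ 2 - a ^ 2 * complex_of_real q ^ (2 * Suc n))) *
            (\<Prod>m=1..<Suc n.
               (complex_of_real (q_int q m) ^ 2 - a ^ 2 * (complex_of_real q ^ m + 1) ^ 2) /
               (complex_of_real (q_int q m) ^ 2 - a ^ 2 * complex_of_real q ^ (2 * m)))) sums S)
     \<and> (\<lambda>n. complex_of_real (q ^ (Suc n ^ 2) * (1 + 2 * q ^ Suc n) /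
            (q_binomial q (2 * Suc n) (Suc n) * q_int q (Suc n) ^ 2))) sums q_zeta q 2"
proof -
  \<comment> \<open>The parameter a is abstracted in both series because the formula for zeta[2]
    comes from taking it to be 0.\<close>
  define mid where "mid = (\<lambda>(a::complex) n. complex_of_real (q ^ Suc n) /
    (complex_of_real (q_int q (Suc n)) ^ 2 - a ^ 2 * complex_of_real q ^ (2 * Suc n)))"
  define acc where "acc = (\<lambda>(a::complex) n. complex_of_real (q ^ (Suc n ^ 2) * (1 + 2 * q ^ Suc n)) /
    (complex_of_real (q_binomial q (2 * Suc n) (Suc n)) *
      (complex_of_real (q_int q (Suc n)) ^ 2 - a ^ 2 * complex_of_real q ^ (2 * Suc n))) *
    (\<Prod>m=1..<Suc n.
       (complex_of_real (q_int q m) ^ 2 - a ^ 2 * (complex_of_real q ^ m + 1) ^ 2) /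
       (complex_of_real (q_int q m) ^ 2 - a ^ 2 * complex_of_real q ^ (2 * m))))"
  note q = assms(1,2)
  have mid_acc: "summable (mid a) \<and> acc a sums suminf (mid a)" if a: "norm a < 1" for a
  proof -
    define Q where "Q = complex_of_real q"
    define u where "u = 1 + a * (1 - Q)"
    define v where "v = 1 - a * (1 - Q)"
    have nQ: "norm (Q ^ j) = q ^ j" for j
      using q by (simp add: Q_def norm_power)
    have Q1: "Q ^ j \<noteq> 1" if "j > 0" for j
      using nQ[of j] power_strict_decreasing[of 0 j q] that q by auto
    have Q: "1 - Q \<noteq> 0" using Q1[of 1] by simp
    \<comment> \<open>Taking s = a gives the factors with u and s = -a those with v. For j \<ge> 1
      the norm is at least (1 - q^j) - |a| (1 - q), and q^j \<le> q.\<close>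
    have lower: "(1 - q) * (1 - norm a) \<le> norm (1 - (1 + s * (1 - Q)) * Q ^ j)"
      if "j > 0" "norm s = norm a" for j s
    proof -
      have n1: "norm (1 - Q ^ j) = 1 - q ^ j" "norm (1 - Q) = 1 - q"
        using q power_le_one[of q j] norm_of_real[of "1 - q ^ j", where 'a = complex]
          norm_of_real[of "1 - q", where 'a = complex] by (simp_all add: Q_def)
      moreover have "norm (s * (1 - Q) * Q ^ j) \<le> norm (s * (1 - Q))"
        unfolding norm_mult[of _ "Q ^ j"] nQ using q by (intro mult_left_le power_le_one) auto
      moreover have "q ^ j \<le> q"
        using power_decreasing[of 1 j q] q that by simp
      moreover have "norm (1 - Q ^ j) - norm (s * (1 - Q) * Q ^ j)
          \<le> norm ((1 - Q ^ j) - s * (1 - Q) * Q ^ j)"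
        by (rule norm_triangle_ineq2)
      moreover have "(1 - Q ^ j) - s * (1 - Q) * Q ^ j = 1 - (1 + s * (1 - Q)) * Q ^ j"
        by (simp add: algebra_simps)
      moreover have "norm (s * (1 - Q)) = norm a * (1 - q)"
        unfolding norm_mult n1 that(2) ..
      moreover have "(1 - q) * (1 - norm a) = (1 - q) - norm a * (1 - q)"
        by (simp add: algebra_simps)
      ultimately show ?thesis
        using n1 by (simp only:)
    qed
    have pos: "0 < (1 - q) * (1 - norm a)" using q a by simp
    have lu: "(1 - q) * (1 - norm a) \<le> norm (1 - u * Q ^ j)" if "j > 0" for j
      unfolding u_def using lower[of j a] that by simp
    have lv: "(1 - q) * (1 - norm a) \<le> norm (1 - v * Q ^ j)" if "j > 0" for j
      unfolding v_def using lower[of j "- a"] that by simp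
    have d: "complex_of_real (q_int q m) ^ 2 - a ^ 2 * complex_of_real q ^ (2 * m)
        = (1 - u * Q ^ m) * (1 - v * Q ^ m) / (1 - Q) ^ 2" for m
    proof -
      have "(1 - Q ^ m)\<^sup>2 - a\<^sup>2 * (Q ^ m)\<^sup>2 * (1 - Q)\<^sup>2 = (1 - u * Q ^ m) * (1 - v * Q ^ m)"
        unfolding u_def v_def by algebra
      then show ?thesis
        using Q unfolding of_real_q_int Q_def[symmetric] power_even_eq
        by (simp add: field_simps)
    qed
    have e: "complex_of_real (q_int q m) ^ 2 - a ^ 2 * (complex_of_real q ^ m + 1) ^ 2
        = (v - u * Q ^ m) * (u - v * Q ^ m) / (1 - Q) ^ 2" for m
    proof -
      have "(1 - Q ^ m)\<^sup>2 - a\<^sup>2 * (Q ^ m + 1)\<^sup>2 * (1 - Q)\<^sup>2 = (v - u * Q ^ m) * (u - v * Q ^ m)"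
        unfolding u_def v_def by algebra
      then show ?thesis
        using Q unfolding of_real_q_int Q_def[symmetric]
        by (simp add: field_simps)
    qed
    have mid: "mid a = (\<lambda>n. (1 - Q)\<^sup>2 * wz_T Q u v 0 (Q ^ Suc n))"
      unfolding mid_def d wz_T_def
      by (simp add: wz_numer_def wz_denom_def Q_def[symmetric] mult_ac fun_eq_iff)
    have binom: "complex_of_real (q_binomial q n k) = q_binomial Q n k" for n k
      by (simp add: q_binomial_def q_pochhammer_def Q_def)
    have uv: "u + v = 2" by (simp add: u_def v_def)
    have acc: "acc a = (\<lambda>n. (1 - Q)\<^sup>2 * wz_G Q u v n Q)"
    proof
      fix n
      \<comment> \<open>Inside the product the powers of 1 - Q cancel; the square from the isolated
        denominator survives and is the same factor as in \<open>mid\<close>.\<close>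
      have "acc a n = Q ^ (Suc n ^ 2) * (1 + 2 * Q ^ Suc n) /
          (q_binomial Q (2 * Suc n) (Suc n) *
            ((1 - u * Q ^ Suc n) * (1 - v * Q ^ Suc n) / (1 - Q) ^ 2)) *
          (\<Prod>m=1..n. ((v - u * Q ^ m) * (u - v * Q ^ m) / (1 - Q) ^ 2) /
             ((1 - u * Q ^ m) * (1 - v * Q ^ m) / (1 - Q) ^ 2))"
        unfolding acc_def d e binom atLeastLessThanSuc_atLeastAtMost by (simp add: Q_def)
      also have "\<dots> = (1 - Q)\<^sup>2 * wz_G Q u v n Q"
        by (subst wz_G_at_base[OF _ uv]) (use Q Q1 in simp_all)
      finally show "acc a n = (1 - Q)\<^sup>2 * wz_G Q u v n Q" .
    qed
    have wz: "summable (\<lambda>k. wz_T Q u v 0 (Q ^ Suc k))"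
      "(\<lambda>n. wz_G Q u v n Q) sums (\<Sum>k. wz_T Q u v 0 (Q ^ Suc k))"
      unfolding Q_def
      by (rule wz_sums[OF q pos]; fold Q_def; erule lu lv)+
    show ?thesis
      unfolding mid acc suminf_mult[OF wz(1)]
      using summable_mult[OF wz(1)] sums_mult[OF wz(2)] by blast
  qed
  have zeta: "(\<lambda>k. q_zeta q (of_nat (2 * k + 2)) * a ^ (2 * k)) sums suminf (mid a)"
    if "norm a < 1" for a
    unfolding mid_def by (rule zeta_generating_sums[OF q that])
  \<comment> \<open>As 0^0 = 1, the term k = 0 survives; uniqueness of sums then gives the value of
    the middle series at a = 0.\<close>
  have "(\<lambda>k. q_zeta q (of_nat (2 * k + 2)) * 0 ^ (2 * k)) sums q_zeta q 2"
    using powser_sums_zero[of "\<lambda>k. q_zeta q (of_nat (2 * k + 2))"] by (simp add: power_mult)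
  then have "suminf (mid 0) = q_zeta q 2"
    using sums_unique2[OF zeta[of 0]] by simp
  then have "acc 0 sums q_zeta q 2"
    using mid_acc[of 0] by simp
  moreover have "acc 0 = (\<lambda>n. complex_of_real (q ^ (Suc n ^ 2) * (1 + 2 * q ^ Suc n) /
            (q_binomial q (2 * Suc n) (Suc n) * q_int q (Suc n) ^ 2)))"
  proof
    fix n
    \<comment> \<open>At a = 0 each factor of the product has equal numerator and denominator.
      Nonvanishing matters because 0 / 0 would be 0.\<close>
    have "complex_of_real (q_int q m) \<noteq> 0" if "m > 0" for m
      using q_int_ge_1[OF q that] by auto
    then have "(\<Prod>m=1..<Suc n. (complex_of_real (q_int q m))\<^sup>2 / (complex_of_real (q_int q m))\<^sup>2) = 1"
      by (intro prod.neutral) auto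
    then show "acc 0 n = complex_of_real (q ^ (Suc n ^ 2) * (1 + 2 * q ^ Suc n) /
            (q_binomial q (2 * Suc n) (Suc n) * q_int q (Suc n) ^ 2))"
      unfolding acc_def by simp
  qed
  ultimately show ?thesis
    using zeta[OF assms(3)] mid_acc[OF assms(3)] unfolding mid_def acc_def
    by (intro conjI exI[of _ "suminf (mid a)"]) (auto simp: mid_def)
qed

end
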